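(* Every integrally convex set $S \subseteq \mathbb{Z}^n$ can be represented as a Minkowski sum $S = T + G = \{t + g \mid t \in T, g \in G\}$ with a bounded integrally convex set $T \subseteq \mathbb{Z}^n$ and a conic integrally convex set $G \subseteq \mathbb{Z}^n$.
   Context: For $x \in \mathbb{R}^n$, the integral neighborhood of $x$ is $N(x) = \{z \in \mathbb{Z}^n \mid |x_i - z_i| < 1 \ (i=1,\dots,n)\}$. A nonempty set $S \subseteq \mathbb{Z}^n$ is integrally convex if every point $x$ of the convex hull $\overline{S}$ of $S$ lies in the convex hull of $S \cap N(x)$. A set $G \subseteq \mathbb{Z}^n$ is conic if its convex hull is a cone (closed under multiplication by nonnegative scalars). *)

theory Defs
  imports "HOL-Analysis.Analysis"
begin

text \<open>The lattice \<open>\<int>\<^sup>n\<close>, regarded as a subset of \<open>\<real>\<^sup>n\<close>.\<close>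

definition int_lattice :: "(real ^ 'n) set" where
  "int_lattice = {z. \<forall>i. z $ i \<in> \<int>}"

definition integral_nbhd :: "real ^ 'n \<Rightarrow> (real ^ 'n) set" where
  "integral_nbhd x = {z \<in> int_lattice. \<forall>i. \<bar>x $ i - z $ i\<bar> < 1}"

definition integrally_convex :: "(real ^ 'n) set \<Rightarrow> bool" where
  "integrally_convex S \<longleftrightarrow> S \<noteq> {} \<and> S \<subseteq> int_lattice \<and>
     (\<forall>x \<in> convex hull S. x \<in> convex hull (S \<inter> integral_nbhd x))"

text \<open>Not to be confused with the library's \<^const>\<open>conic\<close>, which asks for the set itself,
  rather than its convex hull, to be closed under multiplication by nonnegative scalars.\<close>

definition conic_lattice_set :: "(real ^ 'n) set \<Rightarrow> bool" where
  "conic_lattice_set G \<longleftrightarrow> G \<subseteq> int_lattice \<and> cone (convex hull G)"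

end

theory Submission
  imports Defs
begin

text \<open>
  Let \<open>P\<close> be the convex hull of \<open>S\<close> and \<open>C\<close> its recession cone; take \<open>G\<close> to be the set of
  lattice points of \<open>C\<close>, and \<open>T\<close> the part of \<open>S\<close> in a large integral box.

  Around a point \<open>v\<close> of \<open>S\<close>, integral convexity forces \<open>P\<close> into \<open>v\<close> plus the cone generated by
  the finitely many unit steps from \<open>v\<close> that stay in \<open>S\<close>. Only finitely many such cones occur,
  and their intersection is \<open>C\<close>. Writing the points of \<open>S\<close> in terms of the generators and taking
  integer parts of the coefficients, Dickson's lemma yields a finite \<open>F\<close> with \<open>S \<subseteq> F + G\<close>.

  For integral convexity of \<open>G\<close> it suffices, by Krein--Milman, that the extreme points \<open>e\<close> of
  \<open>C\<close> cut by an integral box are integral. Choose \<open>f \<in> F\<close> extreme in \<open>P\<close> modulo the tangent cone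
  of \<open>C\<close> at \<open>e\<close>. If \<open>f + e\<close> were not integral, integral convexity of \<open>S\<close> would allow moving it
  both ways inside \<open>P\<close> along a direction that fixes its integral coordinates, and by the choice
  of \<open>f\<close> the point \<open>e\<close> could then be moved both ways inside \<open>C\<close>.
\<close>

section \<open>Relations ordering a subsequence of every sequence\<close>

text \<open>For a quasi-order this says that it is a well-quasi-order. Asking for \<open>R\<close>
  between all pairs of a subsequence, not just for one pair, makes conjunction a matter of thinning
  twice, without any transitivity.\<close>

definition subseq_ordered_on :: "'a set \<Rightarrow> ('a \<Rightarrow> 'a \<Rightarrow> bool) \<Rightarrow> bool" where
  "subseq_ordered_on S R \<longleftrightarrow>
     (\<forall>s. range s \<subseteq> S \<longrightarrow>
        (\<exists>r :: nat \<Rightarrow> nat. strict_mono r \<and> (\<forall>m n. m < n \<longrightarrow> R (s (r m)) (s (r n)))))"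

lemma subseq_ordered_onE:
  assumes "subseq_ordered_on S R" "range s \<subseteq> S"
  obtains r :: "nat \<Rightarrow> nat"
  where "strict_mono r" "\<And>m n. m < n \<Longrightarrow> R (s (r m)) (s (r n))"
  using assms unfolding subseq_ordered_on_def by blast

lemma subseq_ordered_on_mono:
  assumes "subseq_ordered_on S R" "\<And>x y. x \<in> S \<Longrightarrow> y \<in> S \<Longrightarrow> R x y \<Longrightarrow> R' x y"
  shows "subseq_ordered_on S R'"
  unfolding subseq_ordered_on_def
proof (intro allI impI)
  fix s :: "nat \<Rightarrow> 'a" assume s: "range s \<subseteq> S"
  from subseq_ordered_onE[OF assms(1) s] obtain r :: "nat \<Rightarrow> nat"
    where "strict_mono r" "\<And>m n. m < n \<Longrightarrow> R (s (r m)) (s (r n))" by blast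
  with s assms(2) show "\<exists>r::nat\<Rightarrow>nat. strict_mono r \<and> (\<forall>m n. m < n \<longrightarrow> R' (s (r m)) (s (r n)))"
    by (meson rangeI subsetD)
qed

lemma subseq_ordered_on_conj:
  assumes "subseq_ordered_on S R" "subseq_ordered_on S R'"
  shows "subseq_ordered_on S (\<lambda>x y. R x y \<and> R' x y)"
  unfolding subseq_ordered_on_def
proof (intro allI impI)
  fix s :: "nat \<Rightarrow> 'a" assume s: "range s \<subseteq> S"
  from subseq_ordered_onE[OF assms(1) s] obtain r :: "nat \<Rightarrow> nat"
    where r: "strict_mono r" "\<And>m n. m < n \<Longrightarrow> R (s (r m)) (s (r n))" by blast
  have "range (\<lambda>n. s (r n)) \<subseteq> S" using s by auto
  from subseq_ordered_onE[OF assms(2) this] obtain q :: "nat \<Rightarrow> nat"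
    where q: "strict_mono q" "\<And>m n. m < n \<Longrightarrow> R' (s (r (q m))) (s (r (q n)))" by blast
  have "strict_mono (\<lambda>n. r (q n))" using r(1) q(1) by (simp add: strict_mono_def)
  moreover have "R (s (r (q m))) (s (r (q n)))" if "m < n" for m n
    using r(2) strict_monoD[OF q(1) that] by blast
  ultimately show "\<exists>r::nat\<Rightarrow>nat. strict_mono r \<and>
      (\<forall>m n. m < n \<longrightarrow> R (s (r m)) (s (r n)) \<and> R' (s (r m)) (s (r n)))"
    using q(2) by (intro exI[of _ "\<lambda>n. r (q n)"] conjI allI impI)
qed

text \<open>Together with \<open>subseq_ordered_on_nat\<close> this is Dickson's lemma for finitely
  many coordinates.\<close>

lemma subseq_ordered_on_ball:
  assumes "finite J" "\<And>j. j \<in> J \<Longrightarrow> subseq_ordered_on S (R j)"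
  shows "subseq_ordered_on S (\<lambda>x y. \<forall>j\<in>J. R j x y)"
  using assms
proof (induction J)
  case empty
  then show ?case unfolding subseq_ordered_on_def by (auto intro: strict_mono_id)
next
  case (insert j J)
  have "subseq_ordered_on S (\<lambda>x y. R j x y \<and> (\<forall>j\<in>J. R j x y))"
    using insert by (intro subseq_ordered_on_conj) auto
  then show ?case by (rule subseq_ordered_on_mono) auto
qed

lemma subseq_ordered_on_nat:
  fixes f :: "'a \<Rightarrow> nat"
  shows "subseq_ordered_on S (\<lambda>x y. f x \<le> f y)"
  unfolding subseq_ordered_on_def
proof (intro allI impI)
  fix s :: "nat \<Rightarrow> 'a"
  obtain q where q: "strict_mono q" "monoseq (\<lambda>n. f (s (q n)))"
    using seq_monosub[of "\<lambda>n. f (s n)"] by blast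
  show "\<exists>r::nat\<Rightarrow>nat. strict_mono r \<and> (\<forall>m n. m < n \<longrightarrow> f (s (r m)) \<le> f (s (r n)))"
  proof (cases "incseq (\<lambda>n. f (s (q n)))")
    case True
    then show ?thesis using q(1) by (intro exI[of _ q]) (auto simp: incseq_def)
  next
    case False
    then have dec: "decseq (\<lambda>n. f (s (q n)))" using q(2) by (auto simp: monoseq_iff)
    \<comment> \<open>A nonincreasing sequence of naturals is constant once it has reached its
      minimum \<open>L\<close>.\<close>
    define L where "L = (LEAST k. k \<in> range (\<lambda>n. f (s (q n))))"
    have "L \<in> range (\<lambda>n. f (s (q n)))" unfolding L_def by (rule LeastI) blast
    then obtain N where N: "f (s (q N)) = L" by auto
    have "L \<le> f (s (q n))" for n unfolding L_def by (rule Least_le) blast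
    moreover have "f (s (q n)) \<le> L" if "N \<le> n" for n using decseqD[OF dec that] N by simp
    ultimately have eq: "f (s (q n)) = L" if "N \<le> n" for n using that le_antisym by blast
    have "strict_mono (\<lambda>n. q (N + n))" using q(1) by (simp add: strict_mono_def)
    then show ?thesis using eq by (intro exI[of _ "\<lambda>n. q (N + n)"]) simp
  qed
qed

lemma subseq_ordered_on_finite_range:
  assumes "finite (f ` S)"
  shows "subseq_ordered_on S (\<lambda>x y. f x = f y)"
proof -
  obtain h :: "_ \<Rightarrow> nat" and N where h: "h ` f ` S = {i. i < N}" "inj_on h (f ` S)"
    using finite_imp_inj_to_nat_seg[OF assms] by blast
  have lt: "h (f x) < N" if "x \<in> S" for x using h(1) that by blast
  \<comment> \<open>Equality is expressed by two orders: \<open>h\<close> and its reflection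
    \<open>N - h\<close> both nondecreasing. The bound \<open>lt\<close> keeps the truncated
    subtraction faithful.\<close>
  have "subseq_ordered_on S (\<lambda>x y. h (f x) \<le> h (f y) \<and> N - h (f x) \<le> N - h (f y))"
    by (intro subseq_ordered_on_conj subseq_ordered_on_nat)
  then show ?thesis
  proof (rule subseq_ordered_on_mono)
    fix x y assume xy: "x \<in> S" "y \<in> S" "h (f x) \<le> h (f y) \<and> N - h (f x) \<le> N - h (f y)"
    then have "h (f x) = h (f y)" using lt[of x] lt[of y] by linarith
    then show "f x = f y" using h(2) xy by (auto dest: inj_onD)
  qed
qed

text \<open>If no finite set worked, one could keep picking elements to which no earlier one is
  \<open>R\<close>-related, and the resulting sequence would have no ordered subsequence. The case
  \<open>t = s\<close> is there because \<open>R\<close> need not be reflexive.\<close>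

lemma subseq_ordered_on_finite_basis:
  assumes "subseq_ordered_on S R"
  obtains F where "finite F" "F \<subseteq> S" "\<And>s. s \<in> S \<Longrightarrow> \<exists>t\<in>F. t = s \<or> R t s"
proof (rule ccontr)
  note basis = that
  assume "\<not> thesis"
  then have bad: "\<exists>s\<in>S. \<forall>t\<in>F. t \<noteq> s \<and> \<not> R t s" if "finite F" "F \<subseteq> S" for F
    using basis[OF that] by blast
  have "\<exists>f. \<forall>n::nat. f n \<in> S \<and> (\<forall>m<n. \<not> R (f m) (f n))"
  proof (rule dependent_wellorder_choice)
    fix n :: nat and f :: "nat \<Rightarrow> 'a"
    assume "\<And>y. y < n \<Longrightarrow> f y \<in> S \<and> (\<forall>m<y. \<not> R (f m) (f y))"
    then have "f ` {..<n} \<subseteq> S" by auto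
    from bad[OF _ this] show "\<exists>s. s \<in> S \<and> (\<forall>m<n. \<not> R (f m) s)" by auto
  qed auto
  then obtain f where f: "\<And>n::nat. f n \<in> S" "\<And>m n. m < n \<Longrightarrow> \<not> R (f m) (f n)" by blast
  from f(1) have "range f \<subseteq> S" by auto
  from subseq_ordered_onE[OF assms this] obtain r :: "nat \<Rightarrow> nat"
    where "strict_mono r" "\<And>m n. m < n \<Longrightarrow> R (f (r m)) (f (r n))" by blast
  then have "R (f (r 0)) (f (r 1))" "r 0 < r 1" by (auto simp: strict_mono_def)
  with f(2) show False by blast
qed

section \<open>Convex cones\<close>

lemma convex_cone_sum:
  assumes "convex_cone K" "\<And>i. i \<in> A \<Longrightarrow> f i \<in> K"
  shows "sum f A \<in> K"
  using assms(2)
  by (induction A rule: infinite_finite_induct)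
     (auto intro: convex_cone_add convex_cone_contains_0 assms(1))

lemma convex_cone_hull_finite_explicit:
  assumes "finite B" "x \<in> convex_cone hull B"
  obtains u where "\<And>b. b \<in> B \<Longrightarrow> 0 \<le> u b" "x = (\<Sum>b\<in>B. u b *\<^sub>R b)"
proof -
  let ?K = "{x. \<exists>u. (\<forall>b\<in>B. 0 \<le> u b) \<and> x = (\<Sum>b\<in>B. u b *\<^sub>R b)}"
  have "convex_cone hull B \<subseteq> ?K"
  proof (rule hull_minimal)
    show "B \<subseteq> ?K"
    proof
      fix b assume "b \<in> B"
      then have "b = (\<Sum>c\<in>B. (if c = b then 1 else 0) *\<^sub>R c)"
        using assms(1) by (simp add: if_distrib[of "\<lambda>t. t *\<^sub>R _"] cong: if_cong)
      then show "b \<in> ?K" by (intro CollectI exI[of _ "\<lambda>c. if c = b then 1 else 0"]) auto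
    qed
    show "convex_cone ?K"
      unfolding convex_cone_iff
    proof (intro conjI ballI allI impI)
      show "0 \<in> ?K" by (intro CollectI exI[of _ "\<lambda>_. 0"]) auto
      show "x + y \<in> ?K" if "x \<in> ?K" "y \<in> ?K" for x y
      proof -
        from that obtain u w where "\<forall>b\<in>B. 0 \<le> u b" "x = (\<Sum>b\<in>B. u b *\<^sub>R b)"
          "\<forall>b\<in>B. 0 \<le> w b" "y = (\<Sum>b\<in>B. w b *\<^sub>R b)" by blast
        then show ?thesis
          by (intro CollectI exI[of _ "\<lambda>b. u b + w b"]) (auto simp: scaleR_add_left sum.distrib)
      qed
      show "c *\<^sub>R x \<in> ?K" if "x \<in> ?K" "0 \<le> c" for x c
      proof -
        from that obtain u where "\<forall>b\<in>B. 0 \<le> u b" "x = (\<Sum>b\<in>B. u b *\<^sub>R b)" by blast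
        then show ?thesis using that(2)
          by (intro CollectI exI[of _ "\<lambda>b. c * u b"]) (auto simp: scaleR_sum_right)
      qed
    qed
  qed
  with assms(2) that show ?thesis by blast
qed

text \<open>\<open>f\<close> acts as an extreme point of \<open>convex hull T + K\<close> up to the
  lines in \<open>K\<close>. If \<open>K\<close> contains lines there are no genuine extreme points,
  so \<open>d\<close> is confined to the lineality space of \<open>K\<close> instead of being
  zero.\<close>

lemma extreme_point_modulo_cone:
  fixes K :: "'a::real_vector set"
  assumes "finite T" "T \<noteq> {}" and K: "convex_cone K"
  obtains f where "f \<in> T"
    "\<And>d. f + d \<in> convex hull T + K \<Longrightarrow> f - d \<in> convex hull T + K \<Longrightarrow> d \<in> K \<and> - d \<in> K"
proof -
  have KK: "A + K + K \<subseteq> A + K" for A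
  proof
    fix x assume "x \<in> A + K + K"
    then obtain a k k' where "a \<in> A" "k \<in> K" "k' \<in> K" "x = a + k + k'"
      by (elim set_plus_elim) blast
    then show "x \<in> A + K" using convex_cone_add[OF K, of k k'] by (auto simp: add.assoc)
  qed
  have cK: "convex K" using K by (simp add: convex_cone_def)
  have hull_step: "convex hull A + K \<subseteq> convex hull B + K" if "A \<subseteq> convex hull B + K" for A B
  proof -
    have "convex hull A \<subseteq> convex hull B + K"
      using that by (intro hull_minimal convex_set_plus convex_convex_hull cK)
    then have "convex hull A + K \<subseteq> convex hull B + K + K" by (rule set_plus_mono2) simp
    also have "\<dots> \<subseteq> convex hull B + K" by (rule KK)
    finally show ?thesis .
  qed
  have inc: "A \<subseteq> convex hull A + K" for A
    using convex_cone_contains_0[OF K] hull_subset[of A convex]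
    by (metis add.right_neutral set_plus_intro subset_iff)
  \<comment> \<open>a subset of least size generating \<open>T\<close> modulo \<open>K\<close> consists of the points sought\<close>
  let ?good = "\<lambda>A. A \<subseteq> T \<and> T \<subseteq> convex hull A + K"
  have "?good T" using inc by blast
  then obtain A where A: "?good A" and least: "\<And>B. ?good B \<Longrightarrow> card A \<le> card B"
    using ex_has_least_nat[of ?good T card] by blast
  have finA: "finite A" using A assms(1) finite_subset by blast
  have "A \<noteq> {}" using A assms(2) by (auto simp: set_plus_def)
  then obtain f where f: "f \<in> A" by blast
  define B where "B = A - {f}"
  have AB: "A = insert f B" "f \<notin> B" using f by (auto simp: B_def)
  have notin: "f \<notin> convex hull B + K"
  proof
    assume "f \<in> convex hull B + K"
    then have "A \<subseteq> convex hull B + K" using inc[of B] AB(1) by blast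
    then have "T \<subseteq> convex hull B + K" using hull_step A by blast
    then have "card A \<le> card B" using least A AB(1) by blast
    then show False using card_Diff1_less[OF finA f] by (simp add: B_def)
  qed
  \<comment> \<open>The alternative \<open>u = 0\<close> covers an empty \<open>B\<close>, where no
    hull point \<open>b\<close> is available.\<close>
  have rep: "\<exists>u k b. 0 \<le> u \<and> u \<le> 1 \<and> k \<in> K \<and> x = (1 - u) *\<^sub>R f + u *\<^sub>R b + k \<and> (u = 0 \<or> b \<in> convex hull B)"
    if "x \<in> convex hull T + K" for x
  proof -
    have "x \<in> convex hull A + K" using that hull_step A by blast
    then obtain a k where a: "a \<in> convex hull A" "k \<in> K" "x = a + k" by (elim set_plus_elim)
    show ?thesis
    proof (cases "B = {}")
      case True
      then have "a = f" using a(1) AB by simp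
      then show ?thesis using a by (intro exI[of _ 0] exI[of _ k]) auto
    next
      case False
      then obtain u b where "a = (1 - u) *\<^sub>R f + u *\<^sub>R b" "0 \<le> u" "u \<le> 1" "b \<in> convex hull B"
        using a(1) unfolding AB(1) convex_hull_insert_alt by auto
      then show ?thesis using a by (intro exI[of _ u] exI[of _ k] exI[of _ b]) auto
    qed
  qed
  show ?thesis
  proof (rule that)
    show "f \<in> T" using A f by blast
    fix d assume "f + d \<in> convex hull T + K" "f - d \<in> convex hull T + K"
    note rep[OF this(1)] and rep[OF this(2)]
    then obtain u k b u' k' b' where
      1: "0 \<le> u" "u \<le> 1" "k \<in> K" "f + d = (1 - u) *\<^sub>R f + u *\<^sub>R b + k" "u = 0 \<or> b \<in> convex hull B" and
      2: "0 \<le> u'" "u' \<le> 1" "k' \<in> K" "f - d = (1 - u') *\<^sub>R f + u' *\<^sub>R b' + k'" "u' = 0 \<or> b' \<in> convex hull B"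
      by (elim exE conjE) (rule that; assumption)
    \<comment> \<open>Adding the two representations cancels \<open>d\<close>. If
      \<open>u + u'\<close> were positive, dividing by it would put \<open>f\<close> into
      \<open>convex hull B + K\<close>, against the minimality of \<open>A\<close>.\<close>
    have sum0: "(u + u') *\<^sub>R f = u *\<^sub>R b + u' *\<^sub>R b' + (k + k')"
    proof -
      have "(f + d) + (f - d) = (1 - u) *\<^sub>R f + u *\<^sub>R b + k + ((1 - u') *\<^sub>R f + u' *\<^sub>R b' + k')"
        using 1(4) 2(4) by simp
      then show ?thesis by (simp add: algebra_simps)
    qed
    have "u + u' = 0"
    proof (rule ccontr)
      assume "u + u' \<noteq> 0"
      then have pos: "u + u' > 0" using 1(1) 2(1) by linarith
      let ?w = "u + u'"
      have "f = (1 / ?w) *\<^sub>R (?w *\<^sub>R f)" using pos by simp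
      also have "\<dots> = (u / ?w) *\<^sub>R b + (u' / ?w) *\<^sub>R b' + (1 / ?w) *\<^sub>R (k + k')"
        unfolding sum0 by (simp add: scaleR_add_right)
      finally have feq: "f = (u / ?w) *\<^sub>R b + (u' / ?w) *\<^sub>R b' + (1 / ?w) *\<^sub>R (k + k')" .
      have "(u / ?w) *\<^sub>R b + (u' / ?w) *\<^sub>R b' \<in> convex hull B"
      proof (cases "u = 0 \<or> u' = 0")
        case True
        then show ?thesis using 1(5) 2(5) pos by auto
      next
        case False
        then have "b \<in> convex hull B" "b' \<in> convex hull B" using 1(5) 2(5) by auto
        moreover have "u / ?w + u' / ?w = 1" using pos by (simp flip: add_divide_distrib)
        moreover have "0 \<le> u / ?w" "0 \<le> u' / ?w" using pos 1(1) 2(1) by simp_all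
        ultimately show ?thesis by (intro convexD[OF convex_convex_hull])
      qed
      moreover have "(1 / ?w) *\<^sub>R (k + k') \<in> K"
        using pos 1(3) 2(3) by (intro convex_cone_scaleR[OF K] convex_cone_add[OF K]) auto
      ultimately show False using notin feq by (metis set_plus_intro)
    qed
    then have "u = 0" "u' = 0" using 1(1) 2(1) by linarith+
    then have "d = k" "- d = k'" using 1(4) 2(4) by (simp, metis add_left_cancel diff_conv_add_uminus diff_zero scaleR_one scaleR_zero_left add_0_right)
    then show "d \<in> K \<and> - d \<in> K" using 1(3) 2(3) by simp
  qed
qed

section \<open>Lattice points and integrally convex sets\<close>

lemma int_lattice_add: "x \<in> int_lattice \<Longrightarrow> y \<in> int_lattice \<Longrightarrow> x + y \<in> int_lattice"
  by (simp add: int_lattice_def)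

lemma int_lattice_diff: "x \<in> int_lattice \<Longrightarrow> y \<in> int_lattice \<Longrightarrow> x - y \<in> int_lattice"
  by (simp add: int_lattice_def)

lemma int_lattice_zero: "0 \<in> int_lattice"
  by (simp add: int_lattice_def)

lemma int_lattice_sum_nat:
  assumes "D \<subseteq> int_lattice"
  shows "(\<Sum>d\<in>D. real (n d) *\<^sub>R d) \<in> int_lattice"
  using assms by (auto simp: int_lattice_def intro!: Ints_sum Ints_mult)

lemma finite_int_lattice_bounded:
  "finite {z :: real ^ 'n. z \<in> int_lattice \<and> (\<forall>i. \<bar>z $ i\<bar> \<le> B)}"
proof -
  let ?f = "\<lambda>h :: 'n \<Rightarrow> int. (\<chi> i. real_of_int (h i)) :: real ^ 'n"
  have "z \<in> ?f ` (UNIV \<rightarrow>\<^sub>E {- \<lceil>B\<rceil>..\<lceil>B\<rceil>})"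
    if "z \<in> int_lattice" "\<forall>i. \<bar>z $ i\<bar> \<le> B" for z :: "real ^ 'n"
  proof
    have int: "real_of_int \<lfloor>z $ i\<rfloor> = z $ i" for i
      using that(1) by (simp add: int_lattice_def)
    show "z = ?f (\<lambda>i. \<lfloor>z $ i\<rfloor>)" by (simp add: vec_eq_iff int)
    have "- \<lceil>B\<rceil> \<le> \<lfloor>z $ i\<rfloor> \<and> \<lfloor>z $ i\<rfloor> \<le> \<lceil>B\<rceil>" for i
    proof -
      have "\<bar>real_of_int \<lfloor>z $ i\<rfloor>\<bar> \<le> real_of_int \<lceil>B\<rceil>"
        using that(2) int[of i] le_of_int_ceiling[of B] by (metis order_trans)
      then show ?thesis by linarith
    qed
    then show "(\<lambda>i. \<lfloor>z $ i\<rfloor>) \<in> UNIV \<rightarrow>\<^sub>E {- \<lceil>B\<rceil>..\<lceil>B\<rceil>}" by auto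
  qed
  then have "{z. z \<in> int_lattice \<and> (\<forall>i. \<bar>z $ i\<bar> \<le> B)} \<subseteq> ?f ` (UNIV \<rightarrow>\<^sub>E {- \<lceil>B\<rceil>..\<lceil>B\<rceil>})"
    by blast
  then show ?thesis by (rule finite_subset) (intro finite_imageI finite_PiE; simp)
qed

lemma integral_nbhd_subset_int_lattice: "integral_nbhd x \<subseteq> int_lattice"
  by (auto simp: integral_nbhd_def)

lemma integral_nbhd_bounded:
  assumes "z \<in> integral_nbhd x"
  shows "\<bar>z $ i\<bar> \<le> norm x + 1"
proof -
  have "\<bar>x $ i - z $ i\<bar> < 1" using assms by (simp add: integral_nbhd_def)
  then show ?thesis using component_le_norm_cart[of x i] by linarith
qed

lemma integral_nbhd_eq_at_integer:
  assumes "z \<in> integral_nbhd x" "x $ i \<in> \<int>"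
  shows "z $ i = x $ i"
proof -
  have "x $ i - z $ i \<in> \<int>" "\<bar>x $ i - z $ i\<bar> < 1"
    using assms by (auto simp: integral_nbhd_def int_lattice_def)
  then show ?thesis using Ints_nonzero_abs_less1 by fastforce
qed

lemma integrally_convexD:
  assumes "integrally_convex S" "x \<in> convex hull S"
  shows "x \<in> convex hull (S \<inter> integral_nbhd x)"
  using assms by (simp add: integrally_convex_def)

lemma integrally_convex_int_lattice: "integrally_convex S \<Longrightarrow> S \<subseteq> int_lattice"
  by (simp add: integrally_convex_def)

text \<open>The only integral neighbor of a lattice point is the point itself.\<close>

lemma integrally_convex_hole_free:
  assumes "integrally_convex S" "z \<in> convex hull S" "z \<in> int_lattice"
  shows "z \<in> S"
proof -
  have "w = z" if "w \<in> integral_nbhd z" for w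
    using integral_nbhd_eq_at_integer[OF that] assms(3) by (simp add: vec_eq_iff int_lattice_def)
  then have "S \<inter> integral_nbhd z \<subseteq> {z}" by blast
  then have "S \<inter> integral_nbhd z = {} \<or> S \<inter> integral_nbhd z = {z}" by blast
  then show ?thesis using integrally_convexD[OF assms(1,2)] by auto
qed

text \<open>Near a given point, integral convexity uses only the finitely many points of
  \<open>S\<close> in a fixed box, and their hull is compact.\<close>

lemma closed_hull_integrally_convex:
  fixes S :: "(real ^ 'n) set"
  assumes S: "integrally_convex S"
  shows "closed (convex hull S)"
proof -
  have "y \<in> convex hull S" if y: "y \<in> closure (convex hull S)" for y
  proof -
    \<comment> \<open>Points within distance 1 of \<open>y\<close> have norm at most
      \<open>norm y + 1\<close>; passing to integral neighbors costs another 1.\<close>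
    let ?A = "S \<inter> {z. z \<in> int_lattice \<and> (\<forall>i. \<bar>z $ i\<bar> \<le> norm y + 2)}"
    have cl: "closed (convex hull ?A)"
      by (intro compact_imp_closed finite_imp_compact_convex_hull finite_Int disjI2
          finite_int_lattice_bounded)
    have "\<exists>x\<in>convex hull ?A. dist x y < e" if "e > 0" for e
    proof -
      have "min e 1 > 0" using that by simp
      then obtain x where x: "x \<in> convex hull S" "dist x y < min e 1"
        using y unfolding closure_approachable by blast
      have "norm x \<le> norm y + 1"
        using x(2) norm_triangle_ineq2[of x y] by (simp add: dist_norm)
      then have "\<bar>z $ i\<bar> \<le> norm y + 2" if "z \<in> integral_nbhd x" for z i
        using integral_nbhd_bounded[OF that, of i] by linarith
      then have "S \<inter> integral_nbhd x \<subseteq> ?A"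
        using integral_nbhd_subset_int_lattice by auto
      then have "x \<in> convex hull ?A"
        using integrally_convexD[OF S x(1)] hull_mono[of _ ?A convex] by blast
      then show ?thesis using x(2) by auto
    qed
    then have "y \<in> convex hull ?A" using closed_approachable[OF cl] by blast
    then show ?thesis using hull_mono[of ?A S convex] by blast
  qed
  then show ?thesis by (simp add: closure_subset_eq[symmetric] subsetI)
qed

section \<open>Recession cones\<close>

definition recession_cone :: "'a::real_vector set \<Rightarrow> 'a set" where
  "recession_cone A = {c. \<forall>p\<in>A. \<forall>t\<ge>0. p + t *\<^sub>R c \<in> A}"

lemma convex_cone_recession_cone: "convex_cone (recession_cone A)"
  unfolding convex_cone_iff
proof (intro conjI ballI allI impI)
  show "0 \<in> recession_cone A" by (simp add: recession_cone_def)
  show "c + c' \<in> recession_cone A" if "c \<in> recession_cone A" "c' \<in> recession_cone A" for c c'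
  proof -
    have "(p + t *\<^sub>R c) + t *\<^sub>R c' \<in> A" if "p \<in> A" "t \<ge> 0" for p t
      using \<open>c \<in> _\<close> \<open>c' \<in> _\<close> that unfolding recession_cone_def by blast
    then show ?thesis by (simp add: recession_cone_def scaleR_add_right add.assoc)
  qed
  show "a *\<^sub>R c \<in> recession_cone A" if "c \<in> recession_cone A" "0 \<le> a" for a c
    using that by (simp add: recession_cone_def)
qed

lemma closed_recession_cone:
  fixes A :: "'a::real_normed_vector set"
  assumes "closed A"
  shows "closed (recession_cone A)"
proof -
  have "recession_cone A = (\<Inter>p\<in>A. \<Inter>t\<in>{0..}. (\<lambda>c. p + t *\<^sub>R c) -` A)"
    by (auto simp: recession_cone_def)
  also have "closed \<dots>"
    by (intro closed_INT ballI closed_vimage assms continuous_intros)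
  finally show ?thesis .
qed

lemma recession_coneD: "c \<in> recession_cone A \<Longrightarrow> p \<in> A \<Longrightarrow> p + c \<in> A"
  unfolding recession_cone_def by (metis (mono_tags, lifting) mem_Collect_eq scaleR_one zero_le_one)

text \<open>From local to global: room along \<open>g\<close> at each point of \<open>S\<close>
  gives, by convexity, room at each point of the hull, and closedness then prolongs every ray
  without end.\<close>

lemma mem_recession_cone_hull:
  fixes S :: "'a::real_normed_vector set"
  assumes cl: "closed (convex hull S)"
    and feasible: "\<And>v. v \<in> S \<Longrightarrow> \<exists>\<epsilon>>0. v + \<epsilon> *\<^sub>R g \<in> convex hull S"
  shows "g \<in> recession_cone (convex hull S)"
proof -
  let ?P = "convex hull S"
  have shrink: "p + s *\<^sub>R g \<in> ?P" if "p \<in> ?P" "p + t *\<^sub>R g \<in> ?P" "0 \<le> s" "s \<le> t" "t > 0" for p s t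
  proof -
    have "(1 - s / t) *\<^sub>R p + (s / t) *\<^sub>R (p + t *\<^sub>R g) \<in> ?P"
      using that by (intro convexD_alt convex_convex_hull) auto
    moreover have "(1 - s / t) *\<^sub>R p + (s / t) *\<^sub>R (p + t *\<^sub>R g) = p + s *\<^sub>R g"
      using that by (simp add: algebra_simps)
    ultimately show ?thesis by simp
  qed
  \<comment> \<open>The points with room along \<open>g\<close> form a convex set containing
    \<open>S\<close>; two of them share the smaller of their step lengths.\<close>
  have "?P \<subseteq> {p \<in> ?P. \<exists>\<epsilon>>0. p + \<epsilon> *\<^sub>R g \<in> ?P}"
  proof (rule hull_minimal)
    show "S \<subseteq> {p \<in> ?P. \<exists>\<epsilon>>0. p + \<epsilon> *\<^sub>R g \<in> ?P}"
      using feasible hull_subset[of S convex] by auto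
    show "convex {p \<in> ?P. \<exists>\<epsilon>>0. p + \<epsilon> *\<^sub>R g \<in> ?P}"
    proof (rule convexI)
      fix p q and a b :: real
      assume "p \<in> {p \<in> ?P. \<exists>\<epsilon>>0. p + \<epsilon> *\<^sub>R g \<in> ?P}" "q \<in> {p \<in> ?P. \<exists>\<epsilon>>0. p + \<epsilon> *\<^sub>R g \<in> ?P}"
        and ab: "0 \<le> a" "0 \<le> b" "a + b = 1"
      then obtain s t where p: "p \<in> ?P" "s > 0" "p + s *\<^sub>R g \<in> ?P"
        and q: "q \<in> ?P" "t > 0" "q + t *\<^sub>R g \<in> ?P" by blast
      let ?r = "min s t"
      have "p + ?r *\<^sub>R g \<in> ?P" "q + ?r *\<^sub>R g \<in> ?P"
        using p q by (auto intro!: shrink[OF p(1,3)] shrink[OF q(1,3)])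
      then have "a *\<^sub>R (p + ?r *\<^sub>R g) + b *\<^sub>R (q + ?r *\<^sub>R g) \<in> ?P"
        using ab by (intro convexD convex_convex_hull)
      also have "a *\<^sub>R (p + ?r *\<^sub>R g) + b *\<^sub>R (q + ?r *\<^sub>R g)
          = (a *\<^sub>R p + b *\<^sub>R q) + (a + b) *\<^sub>R (?r *\<^sub>R g)"
        by (simp only: scaleR_add_right scaleR_add_left ac_simps)
      finally have "(a *\<^sub>R p + b *\<^sub>R q) + ?r *\<^sub>R g \<in> ?P" using ab by simp
      moreover have "a *\<^sub>R p + b *\<^sub>R q \<in> ?P"
        using p q ab by (intro convexD convex_convex_hull)
      moreover have "?r > 0" using p q by simp
      ultimately show "a *\<^sub>R p + b *\<^sub>R q \<in> {p \<in> ?P. \<exists>\<epsilon>>0. p + \<epsilon> *\<^sub>R g \<in> ?P}" by blast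
    qed
  qed
  then have step: "\<exists>\<epsilon>>0. p + \<epsilon> *\<^sub>R g \<in> ?P" if "p \<in> ?P" for p using that by blast
  have "p + t *\<^sub>R g \<in> ?P" if p: "p \<in> ?P" and t: "t \<ge> 0" for p t
  proof -
    let ?A = "{0..t} \<inter> (\<lambda>s. p + s *\<^sub>R g) -` ?P"
    have "compact ?A"
      by (intro compact_Int_closed closed_vimage cl continuous_intros compact_Icc)
    moreover have "0 \<in> ?A" using p t by simp
    ultimately obtain s where s: "s \<in> ?A" and s_max: "\<And>r. r \<in> ?A \<Longrightarrow> r \<le> s"
      using compact_attains_sup[of ?A] by blast
    have "s = t" \<comment> \<open>the ray cannot leave the hull, since every point of the hull has room along \<open>g\<close>\<close>
    proof (rule ccontr)
      assume "s \<noteq> t"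
      then have st: "0 \<le> s" "s < t" using s by auto
      from s step[of "p + s *\<^sub>R g"] obtain e where e: "e > 0" "p + s *\<^sub>R g + e *\<^sub>R g \<in> ?P" by auto
      let ?e = "min e (t - s)"
      have "p + s *\<^sub>R g + ?e *\<^sub>R g \<in> ?P"
        using s st e by (intro shrink[OF _ e(2)]) auto
      then have "s + ?e \<in> ?A" using st e by (auto simp: scaleR_add_left add.assoc)
      then show False using s_max[of "s + ?e"] st e by auto
    qed
    then show ?thesis using s by simp
  qed
  then show ?thesis by (simp add: recession_cone_def)
qed

section \<open>Finite generation\<close>

text \<open>Steps are recorded relative to \<open>v\<close>, so all of them have entries -1, 0 or 1
  and only finitely many step sets occur as \<open>v\<close> varies.\<close>

definition unit_steps :: "(real ^ 'n) set \<Rightarrow> real ^ 'n \<Rightarrow> (real ^ 'n) set" where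
  "unit_steps S v = {d \<in> int_lattice. (\<forall>i. \<bar>d $ i\<bar> \<le> 1) \<and> v + d \<in> S}"

lemma unit_steps_subset: "unit_steps S v \<subseteq> {d. d \<in> int_lattice \<and> (\<forall>i. \<bar>d $ i\<bar> \<le> 1)}"
  by (auto simp: unit_steps_def)

lemma finite_unit_steps: "finite (unit_steps S v)"
  using unit_steps_subset finite_int_lattice_bounded by (rule finite_subset)

lemma finite_range_unit_steps: "finite (unit_steps S ` S)"
proof (rule finite_subset)
  show "unit_steps S ` S \<subseteq> Pow {d. d \<in> int_lattice \<and> (\<forall>i. \<bar>d $ i\<bar> \<le> 1)}"
    using unit_steps_subset by blast
qed (simp add: finite_int_lattice_bounded)

text \<open>A point \<open>x\<close> slightly away from \<open>v\<close> towards \<open>y\<close>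
  has all its integral neighbors within one unit of \<open>v\<close>, so \<open>x - v\<close> is a
  convex combination of unit steps; rescaling gives \<open>y - v\<close>.\<close>

lemma diff_mem_unit_steps_cone:
  assumes S: "integrally_convex S" and v: "v \<in> S" and y: "y \<in> convex hull S"
  shows "y - v \<in> convex_cone hull (unit_steps S v)"
proof -
  \<comment> \<open>This choice gives \<open>e * norm (y - v) < 1\<close>, also for
    \<open>y = v\<close>. Neighbors of \<open>x\<close> then differ from \<open>v\<close> by less
    than 2, hence by at most 1, in each coordinate.\<close>
  define e where "e = 1 / (norm (y - v) + 1)"
  define x where "x = v + e *\<^sub>R (y - v)"
  have "0 < norm (y - v) + 1" by (simp add: add_nonneg_pos)
  then have e: "0 < e" "e \<le> 1" by (simp_all add: e_def)
  have vL: "v \<in> int_lattice" using S v integrally_convex_int_lattice by blast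
  have "v \<in> convex hull S" using v by (rule hull_inc)
  then have "(1 - e) *\<^sub>R v + e *\<^sub>R y \<in> convex hull S"
    using y e by (intro convexD_alt convex_convex_hull) auto
  then have "x \<in> convex hull S" by (simp add: x_def algebra_simps)
  then have x: "x \<in> convex hull (S \<inter> integral_nbhd x)" by (rule integrally_convexD[OF S])
  have "S \<inter> integral_nbhd x \<subseteq> (\<lambda>d. v + d) ` unit_steps S v"
  proof
    fix z assume z: "z \<in> S \<inter> integral_nbhd x"
    then have "z - v \<in> int_lattice"
      using vL integral_nbhd_subset_int_lattice int_lattice_diff by blast
    moreover have "\<bar>(z - v) $ i\<bar> \<le> 1" for i
    proof -
      have "e * norm (y - v) < 1" by (simp add: e_def add_nonneg_pos)
      moreover have "\<bar>(x - v) $ i\<bar> \<le> e * norm (y - v)"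
        using component_le_norm_cart[of "x - v" i] e by (simp add: x_def)
      moreover have "\<bar>x $ i - z $ i\<bar> < 1" using z by (simp add: integral_nbhd_def)
      ultimately have lt: "\<bar>(z - v) $ i\<bar> < 2" unfolding vector_minus_component by linarith
      have "(z - v) $ i \<in> \<int>" using \<open>z - v \<in> int_lattice\<close> by (simp add: int_lattice_def)
      then obtain k where "(z - v) $ i = real_of_int k" by (rule Ints_cases)
      moreover from this lt have "\<bar>k\<bar> < 2" by linarith
      ultimately show ?thesis by simp
    qed
    ultimately have "z - v \<in> unit_steps S v" using z by (simp add: unit_steps_def)
    then show "z \<in> (\<lambda>d. v + d) ` unit_steps S v" by (intro image_eqI[of _ _ "z - v"]) auto
  qed
  then have "x \<in> (\<lambda>d. v + d) ` (convex hull (unit_steps S v))"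
    using x hull_mono unfolding convex_hull_translation[symmetric] by blast
  then have "e *\<^sub>R (y - v) \<in> convex hull (unit_steps S v)" by (auto simp: x_def)
  then have "e *\<^sub>R (y - v) \<in> convex_cone hull (unit_steps S v)"
    using convex_hull_subset_convex_cone_hull by blast
  from convex_cone_hull_mul[OF this, of "1 / e"] e show ?thesis by simp
qed

text \<open>The directions with room at \<open>v\<close> form a convex cone containing all unit
  steps. With \<open>diff_mem_unit_steps_cone\<close> this makes the generated cone exactly the cone
  of feasible directions at \<open>v\<close>.\<close>

lemma unit_steps_cone_feasible:
  assumes v: "v \<in> S" and g: "g \<in> convex_cone hull (unit_steps S v)"
  shows "\<exists>\<epsilon>>0. v + \<epsilon> *\<^sub>R g \<in> convex hull S"
proof -
  let ?P = "convex hull S"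
  let ?K = "{g. \<exists>\<epsilon>>0. v + \<epsilon> *\<^sub>R g \<in> ?P}"
  have vP: "v \<in> ?P" using v by (rule hull_inc)
  have "convex_cone hull (unit_steps S v) \<subseteq> ?K"
  proof (rule hull_minimal)
    show "unit_steps S v \<subseteq> ?K"
    proof
      fix d assume "d \<in> unit_steps S v"
      then have "v + 1 *\<^sub>R d \<in> ?P" by (simp add: unit_steps_def hull_inc)
      then show "d \<in> ?K" by (intro CollectI exI[of _ 1]) auto
    qed
    show "convex_cone ?K"
      unfolding convex_cone_iff
    proof (intro conjI ballI allI impI)
      show "0 \<in> ?K" using vP by (intro CollectI exI[of _ 1]) auto
      show "g + h \<in> ?K" if "g \<in> ?K" "h \<in> ?K" for g h
      proof -
        from that obtain s t where st: "s > 0" "v + s *\<^sub>R g \<in> ?P" "t > 0" "v + t *\<^sub>R h \<in> ?P" by blast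
        \<comment> \<open>The weights \<open>t / (s + t)\<close> and \<open>s / (s + t)\<close> give
          \<open>g\<close> and \<open>h\<close> this same coefficient.\<close>
        let ?r = "s * t / (s + t)"
        have w: "t / (s + t) + s / (s + t) = 1" using st by (simp add: add.commute flip: add_divide_distrib)
        have "(t / (s + t)) *\<^sub>R (v + s *\<^sub>R g) + (s / (s + t)) *\<^sub>R (v + t *\<^sub>R h) \<in> ?P"
          using st w by (intro convexD[OF convex_convex_hull]) simp_all
        also have "(t / (s + t)) *\<^sub>R (v + s *\<^sub>R g) + (s / (s + t)) *\<^sub>R (v + t *\<^sub>R h)
            = (t / (s + t) + s / (s + t)) *\<^sub>R v + ?r *\<^sub>R (g + h)"
          by (simp only: scaleR_add_right scaleR_add_left scaleR_scaleR) (simp add: ac_simps)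
        finally have "v + ?r *\<^sub>R (g + h) \<in> ?P" using w by simp
        moreover have "?r > 0" using st by simp
        ultimately show ?thesis by blast
      qed
      show "c *\<^sub>R g \<in> ?K" if "g \<in> ?K" "0 \<le> c" for g c
      proof (cases "c = 0")
        case True
        then show ?thesis using vP by (intro CollectI exI[of _ 1]) auto
      next
        case False
        from that obtain s where "s > 0" "v + s *\<^sub>R g \<in> ?P" by blast
        then show ?thesis using False that(2) by (intro CollectI exI[of _ "s / c"]) auto
      qed
    qed
  qed
  then show ?thesis using g by blast
qed

text \<open>Coefficients of \<open>s - v\<close> over the steps split into integer parts
  \<open>n s\<close> and a remainder \<open>r s\<close>. The remainders are lattice points in a
  bounded box, hence finitely many; where they agree and the integer parts grow, the difference is a
  nonnegative combination of steps.\<close>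

lemma subseq_ordered_on_unit_steps_cone:
  assumes S: "integrally_convex S" and v: "v \<in> S"
  shows "subseq_ordered_on S (\<lambda>x y. y - x \<in> convex_cone hull (unit_steps S v))"
proof -
  let ?D = "unit_steps S v"
  have fin: "finite ?D" by (rule finite_unit_steps)
  have "\<exists>u. (\<forall>d\<in>?D. 0 \<le> u d) \<and> s - v = (\<Sum>d\<in>?D. u d *\<^sub>R d)" if "s \<in> S" for s
    using convex_cone_hull_finite_explicit[OF fin diff_mem_unit_steps_cone[OF S v hull_inc[OF that]]]
    by metis
  then obtain u where u: "\<And>s d. s \<in> S \<Longrightarrow> d \<in> ?D \<Longrightarrow> 0 \<le> u s d"
      "\<And>s. s \<in> S \<Longrightarrow> s - v = (\<Sum>d\<in>?D. u s d *\<^sub>R d)"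
    by metis
  define n where "n s d = nat \<lfloor>u s d\<rfloor>" for s d
  define r where "r s = s - v - (\<Sum>d\<in>?D. real (n s d) *\<^sub>R d)" for s
  have "r s \<in> int_lattice \<and> (\<forall>i. \<bar>r s $ i\<bar> \<le> real (card ?D))" if s: "s \<in> S" for s
  proof
    have DL: "?D \<subseteq> int_lattice" using unit_steps_subset by blast
    have "s \<in> int_lattice" "v \<in> int_lattice"
      using S s v integrally_convex_int_lattice by blast+
    then show "r s \<in> int_lattice"
      unfolding r_def by (intro int_lattice_diff int_lattice_sum_nat DL)
    show "\<forall>i. \<bar>r s $ i\<bar> \<le> real (card ?D)"
    proof
      fix i
      have "r s $ i = (\<Sum>d\<in>?D. (u s d - real (n s d)) * d $ i)"
        unfolding r_def u(2)[OF s] by (simp add: sum_subtractf left_diff_distrib)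
      also have "\<bar>\<dots>\<bar> \<le> (\<Sum>d\<in>?D. \<bar>(u s d - real (n s d)) * d $ i\<bar>)" by (rule sum_abs)
      also have "\<dots> \<le> (\<Sum>d\<in>?D. 1)"
      proof (rule sum_mono)
        fix d assume d: "d \<in> ?D"
        have "\<bar>u s d - real (n s d)\<bar> \<le> 1" using u(1)[OF s d] unfolding n_def by linarith
        moreover have "\<bar>d $ i\<bar> \<le> 1" using d by (simp add: unit_steps_def)
        ultimately show "\<bar>(u s d - real (n s d)) * d $ i\<bar> \<le> 1"
          by (simp add: abs_mult mult_le_one)
      qed
      finally show "\<bar>r s $ i\<bar> \<le> real (card ?D)" by simp
    qed
  qed
  then have "r ` S \<subseteq> {z. z \<in> int_lattice \<and> (\<forall>i. \<bar>z $ i\<bar> \<le> real (card ?D))}" by blast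
  then have "finite (r ` S)" using finite_int_lattice_bounded by (rule finite_subset)
  then have "subseq_ordered_on S (\<lambda>x y. r x = r y \<and> (\<forall>d\<in>?D. n x d \<le> n y d))"
    by (intro subseq_ordered_on_conj subseq_ordered_on_finite_range subseq_ordered_on_ball
        subseq_ordered_on_nat fin)
  then show ?thesis
  proof (rule subseq_ordered_on_mono)
    fix x y assume *: "r x = r y \<and> (\<forall>d\<in>?D. n x d \<le> n y d)"
    then have "y - x = (\<Sum>d\<in>?D. real (n y d) *\<^sub>R d) - (\<Sum>d\<in>?D. real (n x d) *\<^sub>R d)"
      by (simp add: r_def algebra_simps)
    also have "\<dots> = (\<Sum>d\<in>?D. (real (n y d) - real (n x d)) *\<^sub>R d)"
      by (simp add: sum_subtractf scaleR_left_diff_distrib)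
    also have "\<dots> \<in> convex_cone hull ?D"
      using * by (intro convex_cone_sum convex_cone_convex_cone_hull convex_cone_hull_mul hull_inc) auto
    finally show "y - x \<in> convex_cone hull ?D" .
  qed
qed

text \<open>A difference lying in the step cones of all \<open>v\<close> has room at every point of
  \<open>S\<close>, so it is a recession direction. As only finitely many cones occur, they can be
  treated simultaneously.\<close>

lemma subseq_ordered_on_recession_cone:
  assumes S: "integrally_convex S"
  shows "subseq_ordered_on S (\<lambda>x y. y - x \<in> recession_cone (convex hull S))"
proof -
  have "subseq_ordered_on S (\<lambda>x y. \<forall>D\<in>unit_steps S ` S. y - x \<in> convex_cone hull D)"
    using subseq_ordered_on_unit_steps_cone[OF S]
    by (intro subseq_ordered_on_ball finite_range_unit_steps) auto
  then show ?thesis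
  proof (rule subseq_ordered_on_mono)
    fix x y assume "\<forall>D\<in>unit_steps S ` S. y - x \<in> convex_cone hull D"
    then show "y - x \<in> recession_cone (convex hull S)"
      by (intro mem_recession_cone_hull closed_hull_integrally_convex S unit_steps_cone_feasible) auto
  qed
qed

lemma integrally_convex_finite_generation:
  assumes S: "integrally_convex S"
  obtains F where "finite F" "F \<subseteq> S" "F \<noteq> {}" "S \<subseteq> F + (recession_cone (convex hull S) \<inter> int_lattice)"
proof -
  let ?C = "recession_cone (convex hull S)"
  obtain F where F: "finite F" "F \<subseteq> S" "\<And>s. s \<in> S \<Longrightarrow> \<exists>t\<in>F. t = s \<or> s - t \<in> ?C"
    using subseq_ordered_on_finite_basis[OF subseq_ordered_on_recession_cone[OF S]] by metis
  have "S \<noteq> {}" using S by (simp add: integrally_convex_def)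
  then have "F \<noteq> {}" using F(3) by blast
  moreover have "S \<subseteq> F + (?C \<inter> int_lattice)"
  proof
    fix s assume s: "s \<in> S"
    then obtain t where t: "t \<in> F" "t = s \<or> s - t \<in> ?C" using F(3) by blast
    have "0 \<in> ?C" by (intro convex_cone_contains_0 convex_cone_recession_cone)
    then have "s - t \<in> ?C" using t(2) by auto
    moreover have "s - t \<in> int_lattice"
      using s t(1) F(2) integrally_convex_int_lattice[OF S] by (intro int_lattice_diff) auto
    ultimately have "t + (s - t) \<in> F + (?C \<inter> int_lattice)" using t(1) by (intro set_plus_intro) auto
    then show "s \<in> F + (?C \<inter> int_lattice)" by simp
  qed
  ultimately show ?thesis using that F by blast
qed

section \<open>Integrality of the recession cone\<close>

text \<open>Extreme points of a hull belong to the generating set, so \<open>y\<close> lies strictly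
  inside some segment of the hull.\<close>

lemma not_mem_convex_hull_direction:
  assumes "y \<in> convex hull A" "y \<notin> A"
  obtains d where "d \<noteq> 0" "y + d \<in> convex hull A" "y - d \<in> convex hull A"
proof -
  have "\<not> y extreme_point_of (convex hull A)" using assms extreme_point_of_convex_hull by blast
  then obtain p q where pq: "p \<in> convex hull A" "q \<in> convex hull A" "y \<in> open_segment p q"
    using assms(1) unfolding extreme_point_of_def by blast
  then obtain u where u: "p \<noteq> q" "0 < u" "u < 1" "y = (1 - u) *\<^sub>R p + u *\<^sub>R q"
    by (auto simp: in_segment)
  \<comment> \<open>In the parameter of the segment, the distance from \<open>y\<close> to its
    nearer end, so that both moves stay on the segment.\<close>
  define m where "m = min u (1 - u)"
  have m: "0 < m" "m \<le> u" "m \<le> 1 - u" using u by (auto simp: m_def)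
  have "(1 - (u + s)) *\<^sub>R p + (u + s) *\<^sub>R q \<in> convex hull A" if "\<bar>s\<bar> \<le> m" for s
    using that m u by (intro convexD_alt convex_convex_hull pq) auto
  moreover have "(1 - (u + s)) *\<^sub>R p + (u + s) *\<^sub>R q = y + s *\<^sub>R (q - p)" for s
    by (simp add: u(4) algebra_simps)
  ultimately have "y + s *\<^sub>R (q - p) \<in> convex hull A" if "\<bar>s\<bar> \<le> m" for s using that by simp
  from this[of m] this[of "- m"] m u(1) show ?thesis by (intro that[of "m *\<^sub>R (q - p)"]) auto
qed

lemma extreme_point_recession_cone_box:
  fixes S :: "(real ^ 'n) set"
  assumes S: "integrally_convex S" and a: "a \<in> int_lattice" and b: "b \<in> int_lattice"
    and e: "e extreme_point_of (recession_cone (convex hull S) \<inter> cbox a b)"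
  shows "e \<in> int_lattice"
proof (rule ccontr)
  assume e_not: "e \<notin> int_lattice"
  let ?C = "recession_cone (convex hull S)"
  note C = convex_cone_recession_cone[of "convex hull S"]
  have eC: "e \<in> ?C" and e_box: "e \<in> cbox a b" using e by (auto simp: extreme_point_of_def)
  obtain F where F: "finite F" "F \<subseteq> S" "F \<noteq> {}" "S \<subseteq> F + (?C \<inter> int_lattice)"
    using integrally_convex_finite_generation[OF S] .
  \<comment> \<open>The directions in which one can move a little from \<open>e\<close> inside the
    recession cone, obtained by adjoining the ray of \<open>- e\<close> to it.\<close>
  define K where "K = {d. \<exists>k\<ge>0. d + k *\<^sub>R e \<in> ?C}"
  have K: "convex_cone K"
    unfolding convex_cone_iff
  proof (intro conjI ballI allI impI)
    show "0 \<in> K" unfolding K_def using convex_cone_contains_0[OF C] by (intro CollectI exI[of _ 0]) simp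
    show "x + y \<in> K" if "x \<in> K" "y \<in> K" for x y
    proof -
      from that obtain k l where "k \<ge> 0" "x + k *\<^sub>R e \<in> ?C" "l \<ge> 0" "y + l *\<^sub>R e \<in> ?C"
        unfolding K_def by blast
      then have "k + l \<ge> 0" "(x + k *\<^sub>R e) + (y + l *\<^sub>R e) \<in> ?C" by (auto intro: convex_cone_add[OF C])
      then show ?thesis unfolding K_def
        by (intro CollectI exI[of _ "k + l"]) (simp add: algebra_simps)
    qed
    show "c *\<^sub>R x \<in> K" if "x \<in> K" "0 \<le> c" for x c
    proof -
      from that obtain k where "k \<ge> 0" "x + k *\<^sub>R e \<in> ?C" unfolding K_def by blast
      then have "c * k \<ge> 0" "c *\<^sub>R (x + k *\<^sub>R e) \<in> ?C"
        using that(2) by (auto intro: convex_cone_scaleR[OF C])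
      then show ?thesis unfolding K_def by (intro CollectI exI[of _ "c * k"]) (simp add: algebra_simps)
    qed
  qed
  obtain f where f: "f \<in> F"
    "\<And>d. f + d \<in> convex hull F + K \<Longrightarrow> f - d \<in> convex hull F + K \<Longrightarrow> d \<in> K \<and> - d \<in> K"
    using extreme_point_modulo_cone[OF F(1,3) K] by blast
  have "convex ?C" using C by (simp add: convex_cone_def)
  moreover have "F + (?C \<inter> int_lattice) \<subseteq> convex hull F + ?C"
    by (intro set_plus_mono2 hull_subset Int_lower1)
  ultimately have "convex hull S \<subseteq> convex hull F + ?C"
    using F(4) by (intro hull_minimal convex_set_plus convex_convex_hull) auto
  \<comment> \<open>Subtracting \<open>e\<close> is harmless because \<open>c - e\<close> lies in
    \<open>K\<close> for every recession direction \<open>c\<close>. So \<open>y + d\<close> and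
    \<open>y - d\<close> in the hull of \<open>S\<close> become \<open>f + d\<close> and
    \<open>f - d\<close>, as the choice of \<open>f\<close> requires.\<close>
  then have hull_S: "w - e \<in> convex hull F + K" if "w \<in> convex hull S" for w
  proof -
    from that \<open>convex hull S \<subseteq> _\<close> obtain q c where qc: "q \<in> convex hull F" "c \<in> ?C" "w = q + c"
      by (blast elim: set_plus_elim)
    have "c - e \<in> K" unfolding K_def using qc(2) by (intro CollectI exI[of _ 1]) simp
    then have "q + (c - e) \<in> convex hull F + K" using qc(1) by (intro set_plus_intro)
    then show ?thesis by (simp add: qc(3) algebra_simps)
  qed
  have fS: "f \<in> S" using f(1) F(2) by blast
  then have fL: "f \<in> int_lattice" using integrally_convex_int_lattice[OF S] by blast
  define y where "y = f + e"
  let ?A = "S \<inter> integral_nbhd y"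
  have "y \<in> convex hull S" unfolding y_def using eC fS by (intro recession_coneD hull_inc)
  then have yA: "y \<in> convex hull ?A" by (rule integrally_convexD[OF S])
  have "y \<notin> ?A"
    using e_not int_lattice_diff[OF _ fL, of y] integral_nbhd_subset_int_lattice by (auto simp: y_def)
  with yA obtain d where d: "d \<noteq> 0" "y + d \<in> convex hull ?A" "y - d \<in> convex hull ?A"
    using not_mem_convex_hull_direction by blast
  have AS: "convex hull ?A \<subseteq> convex hull S" by (rule hull_mono) blast
  \<comment> \<open>Since \<open>f\<close> is integral, \<open>e\<close> and \<open>y\<close> are
    integral at the same coordinates, and there all neighbors agree with \<open>y\<close>.\<close>
  have d_zero: "d $ i = 0" if "e $ i \<in> \<int>" for i
  proof -
    have "y $ i \<in> \<int>" using that fL by (simp add: y_def int_lattice_def)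
    then have "convex hull ?A \<subseteq> {w. w $ i = y $ i}"
      using integral_nbhd_eq_at_integer
      by (intro hull_minimal) (auto simp: convex_def simp flip: distrib_right)
    then have "(y + d) $ i = y $ i" using d(2) by blast
    then show ?thesis by simp
  qed
  have "d \<in> K \<and> - d \<in> K"
    using hull_S[of "y + d"] hull_S[of "y - d"] d AS
    by (intro f(2)) (auto simp: y_def algebra_simps)
  then obtain k l where kl: "k \<ge> 0" "d + k *\<^sub>R e \<in> ?C" "l \<ge> 0" "- d + l *\<^sub>R e \<in> ?C"
    unfolding K_def by blast
  \<comment> \<open>The point is the sum of \<open>t *\<^sub>R (c + m *\<^sub>R e)\<close> and the
    nonnegative multiple \<open>(1 - t * m) *\<^sub>R e\<close>.\<close>
  have cone_move: "e + t *\<^sub>R c \<in> ?C" if "c + m *\<^sub>R e \<in> ?C" "0 \<le> t" "t * m \<le> 1" for c t m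
  proof -
    have "t *\<^sub>R (c + m *\<^sub>R e) \<in> ?C" "(1 - t * m) *\<^sub>R e \<in> ?C"
      using that eC convex_cone_scaleR[OF C] by simp_all
    then have "t *\<^sub>R (c + m *\<^sub>R e) + (1 - t * m) *\<^sub>R e \<in> ?C" by (rule convex_cone_add[OF C])
    then show ?thesis by (simp add: algebra_simps)
  qed
  \<comment> \<open>The corners are integral, so a bound can be tight at \<open>e\<close> only in an
    integral coordinate, where \<open>d\<close> vanishes; elsewhere there is slack.\<close>
  have box_ev: "\<forall>\<^sub>F t in at_right 0. a $ i \<le> e $ i + t * c $ i \<and> e $ i + t * c $ i \<le> b $ i"
    if "c = d \<or> c = - d" for c i
  proof (cases "e $ i \<in> \<int>")
    case True
    then have "c $ i = 0" using d_zero that by auto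
    then show ?thesis using e_box by (simp add: mem_box_cart)
  next
    case False
    moreover have "a $ i \<in> \<int>" "b $ i \<in> \<int>" using a b by (auto simp: int_lattice_def)
    ultimately have "a $ i \<noteq> e $ i" "b $ i \<noteq> e $ i" by metis+
    then have lt: "a $ i < e $ i" "e $ i < b $ i"
      using e_box by (auto simp: mem_box_cart less_le)
    have "((\<lambda>t. e $ i + t * c $ i) \<longlongrightarrow> e $ i + 0 * c $ i) (at_right 0)" by (intro tendsto_intros)
    then have "((\<lambda>t. e $ i + t * c $ i) \<longlongrightarrow> e $ i) (at_right 0)" by simp
    from order_tendstoD(1)[OF this lt(1)] order_tendstoD(2)[OF this lt(2)]
    show ?thesis by eventually_elim simp
  qed
  have small_ev: "\<forall>\<^sub>F t in at_right 0. t * m \<le> 1" for m :: real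
  proof -
    have "((\<lambda>t. t * m) \<longlongrightarrow> 0 * m) (at_right 0)" by (intro tendsto_intros)
    then have "\<forall>\<^sub>F t in at_right 0. t * m < 1" by (rule order_tendstoD) simp
    then show ?thesis by eventually_elim simp
  qed
  \<comment> \<open>Finitely many conditions, each true for all small positive \<open>t\<close>,
    share a common \<open>t\<close>.\<close>
  have "\<forall>\<^sub>F t::real in at_right 0. 0 < t \<and> t * k \<le> 1 \<and> t * l \<le> 1
      \<and> (\<forall>i. a $ i \<le> e $ i + t * d $ i \<and> e $ i + t * d $ i \<le> b $ i)
      \<and> (\<forall>i. a $ i \<le> e $ i + t * (- d) $ i \<and> e $ i + t * (- d) $ i \<le> b $ i)"
    by (intro eventually_conj eventually_at_right_less small_ev eventually_all_finite box_ev) auto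
  then obtain t where t: "0 < t" "t * k \<le> 1" "t * l \<le> 1"
      "\<And>i. a $ i \<le> e $ i + t * d $ i \<and> e $ i + t * d $ i \<le> b $ i"
      "\<And>i. a $ i \<le> e $ i + t * (- d) $ i \<and> e $ i + t * (- d) $ i \<le> b $ i"
    using eventually_happens'[OF trivial_limit_at_right_real] by blast
  have "e + t *\<^sub>R d \<in> ?C \<inter> cbox a b" "e + t *\<^sub>R (- d) \<in> ?C \<inter> cbox a b"
    using cone_move[OF kl(2)] cone_move[OF kl(4)] t by (auto simp: mem_box_cart)
  moreover have "e \<in> open_segment (e + t *\<^sub>R d) (e + t *\<^sub>R (- d))"
    unfolding in_segment
  proof (intro conjI exI[of _ "1 / 2"])
    show "e + t *\<^sub>R d \<noteq> e + t *\<^sub>R (- d)" using t(1) d(1) by (simp add: eq_neg_iff_add_eq_0 flip: scaleR_2)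
    show "e = (1 - 1 / 2) *\<^sub>R (e + t *\<^sub>R d) + (1 / 2) *\<^sub>R (e + t *\<^sub>R (- d))"
      by (simp add: vec_eq_iff field_simps)
  qed auto
  ultimately show False using e unfolding extreme_point_of_def by blast
qed

text \<open>Krein--Milman is applied to the cone cut by the smallest integral box around
  \<open>x\<close>: extreme points there are integral, and every point of the box is less than 1
  away from \<open>x\<close> in each coordinate.\<close>

lemma mem_hull_integral_points_recession_cone:
  fixes S :: "(real ^ 'n) set"
  assumes S: "integrally_convex S" and x: "x \<in> recession_cone (convex hull S)"
  shows "x \<in> convex hull (recession_cone (convex hull S) \<inter> int_lattice \<inter> integral_nbhd x)"
proof -
  let ?C = "recession_cone (convex hull S)"
  define a b :: "real ^ 'n"
    where "a = (\<chi> i. real_of_int \<lfloor>x $ i\<rfloor>)" and "b = (\<chi> i. real_of_int \<lceil>x $ i\<rceil>)"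
  have ab: "a \<in> int_lattice" "b \<in> int_lattice" by (auto simp: a_def b_def int_lattice_def)
  let ?B = "?C \<inter> cbox a b"
  have "convex ?C" using convex_cone_recession_cone[of "convex hull S"] by (simp add: convex_cone_def)
  then have "convex ?B" by (intro convex_Int convex_box)
  moreover have "compact ?B"
    by (intro closed_Int_compact closed_recession_cone closed_hull_integrally_convex S compact_cbox)
  ultimately have B: "?B = convex hull {e. e extreme_point_of ?B}" by (intro Krein_Milman_Minkowski)
  have "x \<in> ?B" using x by (simp add: a_def b_def mem_box_cart)
  moreover have "{e. e extreme_point_of ?B} \<subseteq> ?C \<inter> int_lattice \<inter> integral_nbhd x"
  proof
    fix e assume "e \<in> {e. e extreme_point_of ?B}"
    then have e: "e extreme_point_of ?B" by simp
    then have eL: "e \<in> int_lattice" by (rule extreme_point_recession_cone_box[OF S ab])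
    have eB: "e \<in> ?B" using e by (simp add: extreme_point_of_def)
    have "\<bar>x $ i - e $ i\<bar> < 1" for i
    proof -
      have "real_of_int \<lfloor>x $ i\<rfloor> \<le> e $ i" "e $ i \<le> real_of_int \<lceil>x $ i\<rceil>"
        using eB by (auto simp: a_def b_def mem_box_cart)
      then show ?thesis by linarith
    qed
    then show "e \<in> ?C \<inter> int_lattice \<inter> integral_nbhd x" using eL eB by (simp add: integral_nbhd_def)
  qed
  ultimately show ?thesis using B hull_mono by blast
qed

section \<open>Truncation to an integral box and assembly of the two summands\<close>

lemma integrally_convex_inter_box:
  fixes S :: "(real ^ 'n) set"
  assumes S: "integrally_convex S" and ab: "a \<in> int_lattice" "b \<in> int_lattice"
    and ne: "S \<inter> cbox a b \<noteq> {}"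
  shows "integrally_convex (S \<inter> cbox a b)"
  unfolding integrally_convex_def
proof (intro conjI ballI)
  show "S \<inter> cbox a b \<noteq> {}" by (rule ne)
  show "S \<inter> cbox a b \<subseteq> int_lattice" using integrally_convex_int_lattice[OF S] by blast
  fix x assume x: "x \<in> convex hull (S \<inter> cbox a b)"
  then have "x \<in> convex hull S" using hull_mono[of "S \<inter> cbox a b" S convex] by blast
  then have "x \<in> convex hull (S \<inter> integral_nbhd x)" by (rule integrally_convexD[OF S])
  \<comment> \<open>An integer less than 1 away from a number between two integers cannot pass
    either of them.\<close>
  moreover have "integral_nbhd x \<subseteq> cbox a b"
  proof
    fix z assume z: "z \<in> integral_nbhd x"
    have "convex hull (S \<inter> cbox a b) \<subseteq> cbox a b" by (intro hull_minimal convex_box) blast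
    then have xb: "x \<in> cbox a b" using x by blast
    have "a $ i \<le> z $ i \<and> z $ i \<le> b $ i" for i
    proof -
      have "a $ i \<in> \<int>" "z $ i \<in> \<int>" "b $ i \<in> \<int>" "\<bar>x $ i - z $ i\<bar> < 1"
        using z ab by (auto simp: integral_nbhd_def int_lattice_def)
      moreover have "a $ i \<le> x $ i" "x $ i \<le> b $ i" using xb by (auto simp: mem_box_cart)
      ultimately show ?thesis by (auto elim!: Ints_cases)
    qed
    then show "z \<in> cbox a b" by (simp add: mem_box_cart)
  qed
  ultimately show "x \<in> convex hull (S \<inter> cbox a b \<inter> integral_nbhd x)"
    by (metis Int_absorb1 Int_assoc)
qed

theorem theorem3p10:
  fixes S :: "(real ^ 'n) set"
  assumes "integrally_convex S"
  shows "\<exists>T G :: (real ^ 'n) set.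
           integrally_convex T \<and> bounded T \<and>
           integrally_convex G \<and> conic_lattice_set G \<and>
           S = {t + g | t g. t \<in> T \<and> g \<in> G}"
proof -
  define C where "C = recession_cone (convex hull S)"
  define G where "G = C \<inter> int_lattice"
  have C: "convex_cone C" unfolding C_def by (rule convex_cone_recession_cone)
  then have "convex C" by (simp add: convex_cone_def)
  then have "convex hull G \<subseteq> C" by (intro hull_minimal) (auto simp: G_def)
  \<comment> \<open>Used twice: it shows that \<open>G\<close> spans all of \<open>C\<close>, and
    then that \<open>G\<close> is integrally convex.\<close>
  have local: "x \<in> convex hull (G \<inter> integral_nbhd x)" if "x \<in> C" for x
    using mem_hull_integral_points_recession_cone[OF assms] that by (simp add: C_def G_def)
  have "convex hull G = C"
    using \<open>convex hull G \<subseteq> C\<close> local hull_mono[of "G \<inter> integral_nbhd _" G convex] by blast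
  have "0 \<in> G" using convex_cone_contains_0[OF C] by (simp add: G_def int_lattice_zero)
  then have G_ic: "integrally_convex G"
    using local by (auto simp: integrally_convex_def \<open>convex hull G = C\<close>) (simp add: G_def)
  have G_conic: "conic_lattice_set G"
    using convex_cone_scaleR[OF C]
    by (auto simp: conic_lattice_set_def \<open>convex hull G = C\<close> cone_def) (simp add: G_def)
  obtain F where F: "finite F" "F \<subseteq> S" "F \<noteq> {}" "S \<subseteq> F + G"
    using integrally_convex_finite_generation[OF assms] unfolding G_def C_def .
  obtain B where B: "\<And>z. z \<in> F \<Longrightarrow> norm z \<le> B"
    using finite_imp_bounded[OF F(1)] unfolding bounded_iff by blast
  \<comment> \<open>Rounding \<open>B\<close> up makes the corners integral while the box still
    contains all of \<open>F\<close>.\<close>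
  define b :: "real ^ 'n" where "b = (\<chi> i. real_of_int \<lceil>B\<rceil>)"
  define T where "T = S \<inter> cbox (- b) b"
  have "z \<in> cbox (- b) b" if "z \<in> F" for z
  proof -
    have "\<bar>z $ i\<bar> \<le> real_of_int \<lceil>B\<rceil>" for i
      using B[OF that] component_le_norm_cart[of z i] by linarith
    then show ?thesis by (auto simp: mem_box_cart b_def abs_le_iff minus_le_iff)
  qed
  then have FT: "F \<subseteq> T" using F(2) by (auto simp: T_def)
  have "b \<in> int_lattice" "- b \<in> int_lattice" by (auto simp: b_def int_lattice_def)
  then have T_ic: "integrally_convex T"
    unfolding T_def using FT F(3) by (intro integrally_convex_inter_box assms) (auto simp: T_def)
  have T_bdd: "bounded T" unfolding T_def by (intro bounded_Int disjI2 bounded_cbox)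
  have "S = T + G"
  proof
    show "S \<subseteq> T + G" using F(4) set_plus_mono2[OF FT order_refl, of G] by blast
    \<comment> \<open>Recession keeps \<open>t + g\<close> in the hull of \<open>S\<close>, and a
      lattice point of the hull belongs to \<open>S\<close>.\<close>
    show "T + G \<subseteq> S"
    proof
      fix s assume "s \<in> T + G"
      then obtain t g where tg: "t \<in> T" "g \<in> G" "s = t + g" by (rule set_plus_elim)
      then have "t \<in> S" "g \<in> C" "g \<in> int_lattice" by (auto simp: T_def G_def)
      moreover from this have "t + g \<in> convex hull S"
        unfolding C_def by (intro recession_coneD hull_inc)
      moreover have "t + g \<in> int_lattice"
        using \<open>t \<in> S\<close> \<open>g \<in> int_lattice\<close> integrally_convex_int_lattice[OF assms]
        by (intro int_lattice_add) auto
      ultimately show "s \<in> S" using integrally_convex_hole_free[OF assms] tg(3) by blast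
    qed
  qed
  also have "\<dots> = {t + g | t g. t \<in> T \<and> g \<in> G}" by (auto simp: set_plus_def)
  finally show ?thesis using T_ic T_bdd G_ic G_conic by blast
qed

end
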